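(* Algorithm UTH (defined in the context) finds the treasure in every connected graph, in time $O(w(b,t))$, where $w(b,t)$ is the weight of the instance $(b,t)$ of the treasure hunt problem.
   Context: Graphs. A graph is undirected, possibly infinite, with every node of finite or countably infinite degree; self-loops and multiple edges are allowed. Connected means that every pair of nodes is joined by at least one finite path. Ports at a node of finite degree $d$ are arbitrarily numbered $1,\dots,d$; ports at a node of infinite degree are arbitrarily numbered by all distinct positive integers. Nodes are anonymous (no labels are assumed) and cannot be marked. Treasure hunt. An instance is an ordered pair $(b,t)$ of nodes: $b$ (the base) is the starting node of the agent and $t$ is the node where the treasure is located. The agent is deterministic, has unbounded memory and has no a priori knowledge whatsoever. At each step it chooses a port at the current node and traverses the corresponding edge; on entering a node it learns the entry port number. The time of a treasure hunt algorithm is the worst-case number of edge traversals performed by the agent until the treasure is found. Paths, types, weight. A path from $u$ to $v$ is a finite sequence $\pi=(p_1,\dots,p_\delta)$ of port numbers such that taking port $p_1$ at $u$ and then ports $p_2,\dots,p_\delta$ at the subsequent nodes reaches $v$. Its length is $\delta$. The type of $\pi$ is the ordered couple $(m,\delta)$ with $m=\max(p_1,\dots,p_\delta)$. The value of a pair $(x,y)$ of natural numbers is $val(x,y)=y\,2^y x^y$. For an ordered couple $(u,v)$ of nodes, let $minval$ be the smallest value of any type of a path from $u$ to $v$; the character $c(u,v)$ is the lexicographically smallest among all types (of paths from $u$ to $v$) of value $minval$; the weight $w(u,v)$ is the value of $c(u,v)$. Algorithm UTH. For a finite sequence $\pi=(p_1,\dots,p_\delta)$ of port numbers, Procedure Traverse($\pi$)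 starts at the base, follows consecutive ports $p_1,p_2,\dots$ as long as they are available at the subsequently visited nodes, and then takes the reverse path back to the base. For integers $m\ge 2$ and $\delta>0$, Procedure Paths$(m,\delta)$ executes Traverse($\pi$) for all sequences $\pi=(p_1,\dots,p_\delta)$ of positive integers with $\max(p_1,\dots,p_\delta)=m$, in lexicographic order. Algorithm UTH works in phases $j=2,3,4,\dots$. In phase $j$, all pairs $(x,y)$ of integers with $x\ge 2$, $y>0$ and $y\,2^y x^y=j$ are ordered lexicographically, and Paths$(x,y)$ is executed for each of them in this order. The execution stops as soon as the treasure is found.
   Formalization: The O(w(b,t)) bound fails when the character of (b,t) is (1,δ), as UTH never runs all-ones sequences (e.g. the infinite line); it is stated for all other instances, and for character (1,δ) the time is O(val(2,δ)). One constant serves all graphs on a given node and edge type. *)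

theory Defs
  imports
    "Graph_Theory.Bidirected_Digraph"
    "Graph_Theory.Digraph_Component"
    "HOL-Library.Product_Lexorder"
    "HOL-Library.List_Lexorder"
begin

(* An undirected multigraph is a bidirected digraph: an undirected edge is a pair {a, arev a} of
   opposite arcs, and arev a ~= a, so a self-loop contributes two arcs (hence two ports) at its node.
   port a is the port number, at the node tail G a, of the edge traversed by a; the entry port of
   that traversal at head G a is port (arev a). The bijections force all degrees to be countable. *)
locale port_graph = bidirected_digraph G arev
  for G :: "('v, 'e) pre_digraph" and arev :: "'e \<Rightarrow> 'e" +
  fixes port :: "'e \<Rightarrow> nat"
  assumes port_finite:
    "\<And>v. v \<in> verts G \<Longrightarrow> finite (out_arcs G v) \<Longrightarrow> bij_betw port (out_arcs G v) {1..out_degree G v}"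
  and port_infinite:
    "\<And>v. v \<in> verts G \<Longrightarrow> infinite (out_arcs G v) \<Longrightarrow> bij_betw port (out_arcs G v) {1..}"

definition available :: "('v, 'e) pre_digraph \<Rightarrow> ('e \<Rightarrow> nat) \<Rightarrow> 'v \<Rightarrow> nat \<Rightarrow> bool" where
  "available G port v p \<longleftrightarrow> (\<exists>a \<in> out_arcs G v. port a = p)"

definition port_arc :: "('v, 'e) pre_digraph \<Rightarrow> ('e \<Rightarrow> nat) \<Rightarrow> 'v \<Rightarrow> nat \<Rightarrow> 'e" where
  "port_arc G port v p = (THE a. a \<in> out_arcs G v \<and> port a = p)"

fun is_path :: "('v, 'e) pre_digraph \<Rightarrow> ('e \<Rightarrow> nat) \<Rightarrow> 'v \<Rightarrow> nat list \<Rightarrow> 'v \<Rightarrow> bool" where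
  "is_path G port u [] v \<longleftrightarrow> u = v"
| "is_path G port u (p # ps) v \<longleftrightarrow>
     available G port u p \<and> is_path G port (head G (port_arc G port u p)) ps v"

(* The trivial path from a node to itself is given the type (0, 0), of value 0. *)
definition path_type :: "nat list \<Rightarrow> nat \<times> nat" where
  "path_type ps = (Max (insert 0 (set ps)), length ps)"

fun val :: "nat \<times> nat \<Rightarrow> nat" where
  "val (x, y) = y * 2 ^ y * x ^ y"

definition path_types :: "('v, 'e) pre_digraph \<Rightarrow> ('e \<Rightarrow> nat) \<Rightarrow> 'v \<Rightarrow> 'v \<Rightarrow> (nat \<times> nat) set" where
  "path_types G port u v = {path_type ps | ps. is_path G port u ps v}"

definition minval :: "('v, 'e) pre_digraph \<Rightarrow> ('e \<Rightarrow> nat) \<Rightarrow> 'v \<Rightarrow> 'v \<Rightarrow> nat" where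
  "minval G port u v = (LEAST n. n \<in> val ` path_types G port u v)"

(* LEAST on pairs and sorted_list_of_set on pairs and lists refer to the lexicographic orders. *)
definition character :: "('v, 'e) pre_digraph \<Rightarrow> ('e \<Rightarrow> nat) \<Rightarrow> 'v \<Rightarrow> 'v \<Rightarrow> nat \<times> nat" where
  "character G port u v = (LEAST c. c \<in> path_types G port u v \<and> val c = minval G port u v)"

definition weight :: "('v, 'e) pre_digraph \<Rightarrow> ('e \<Rightarrow> nat) \<Rightarrow> 'v \<Rightarrow> 'v \<Rightarrow> nat" where
  "weight G port u v = val (character G port u v)"

fun forward_arcs :: "('v, 'e) pre_digraph \<Rightarrow> ('e \<Rightarrow> nat) \<Rightarrow> 'v \<Rightarrow> nat list \<Rightarrow> 'e list" where
  "forward_arcs G port v [] = []"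
| "forward_arcs G port v (p # ps) =
     (if available G port v p
      then port_arc G port v p # forward_arcs G port (head G (port_arc G port v p)) ps
      else [])"

(* The walk of each procedure is the list of arcs traversed when nothing stops the agent. *)
definition Traverse ::
  "('v, 'e) pre_digraph \<Rightarrow> ('e \<Rightarrow> 'e) \<Rightarrow> ('e \<Rightarrow> nat) \<Rightarrow> 'v \<Rightarrow> nat list \<Rightarrow> 'e list" where
  "Traverse G arev port b ps =
     (let as = forward_arcs G port b ps in as @ map arev (rev as))"

definition port_seqs :: "nat \<Rightarrow> nat \<Rightarrow> nat list set" where
  "port_seqs m \<delta> = {ps. length ps = \<delta> \<and> (\<forall>p \<in> set ps. p > 0) \<and> Max (set ps) = m}"

definition Paths ::
  "('v, 'e) pre_digraph \<Rightarrow> ('e \<Rightarrow> 'e) \<Rightarrow> ('e \<Rightarrow> nat) \<Rightarrow> 'v \<Rightarrow> nat \<times> nat \<Rightarrow> 'e list" where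
  "Paths G arev port b = (\<lambda>(m, \<delta>).
     concat (map (Traverse G arev port b) (sorted_list_of_set (port_seqs m \<delta>))))"

(* Since x >= 2, sequences consisting of ones only are never executed by UTH; consequently its time
   is not linear in the weight for instances of character (1, d): on the infinite line with ports
   1 to the right and 2 to the left, the node at distance d to the right has weight d * 2 ^ d but is
   not visited before phase (d + 1) * 4 ^ (d + 1). *)
definition phase_pairs :: "nat \<Rightarrow> (nat \<times> nat) set" where
  "phase_pairs j = {(x, y). x \<ge> 2 \<and> y > 0 \<and> y * 2 ^ y * x ^ y = j}"

(* sorted_list_of_set is meaningful only on finite sets. *)
lemma finite_port_seqs: "\<delta> > 0 \<Longrightarrow> finite (port_seqs m \<delta>)"
proof (rule finite_subset)
  assume d: "\<delta> > 0"
  show "port_seqs m \<delta> \<subseteq> {ps. set ps \<subseteq> {..m} \<and> length ps = \<delta>}"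
    using d by (auto simp: port_seqs_def)
qed (simp add: finite_lists_length_eq)

lemma finite_phase_pairs: "finite (phase_pairs j)"
proof (rule finite_subset)
  show "phase_pairs j \<subseteq> {..j} \<times> {..j}"
  proof
    fix c assume "c \<in> phase_pairs j"
    then obtain x y where c: "c = (x, y)" and x: "2 \<le> x" and y: "0 < y" and j: "y * 2 ^ y * x ^ y = j"
      by (auto simp: phase_pairs_def)
    have "y > 0 \<Longrightarrow> x dvd j" "y dvd j" unfolding j[symmetric] by (auto simp: dvd_power)
    moreover have "j > 0" unfolding j[symmetric] using x y by simp
    ultimately show "c \<in> {..j} \<times> {..j}" using c y by (auto intro: dvd_imp_le)
  qed
qed simp

definition UTH_phase ::
  "('v, 'e) pre_digraph \<Rightarrow> ('e \<Rightarrow> 'e) \<Rightarrow> ('e \<Rightarrow> nat) \<Rightarrow> 'v \<Rightarrow> nat \<Rightarrow> 'e list" where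
  "UTH_phase G arev port b j =
     concat (map (Paths G arev port b) (sorted_list_of_set (phase_pairs j)))"

(* Phases 2, ..., J, in this order. *)
definition UTH_walk ::
  "('v, 'e) pre_digraph \<Rightarrow> ('e \<Rightarrow> 'e) \<Rightarrow> ('e \<Rightarrow> nat) \<Rightarrow> 'v \<Rightarrow> nat \<Rightarrow> 'e list" where
  "UTH_walk G arev port b J = concat (map (UTH_phase G arev port b) [2..<Suc J])"

(* at_after ... b t n: during some finite number of phases UTH makes at least n edge traversals,
   and it is at t after exactly n of them. The walks for increasing J extend one another. *)
definition at_after ::
  "('v, 'e) pre_digraph \<Rightarrow> ('e \<Rightarrow> 'e) \<Rightarrow> ('e \<Rightarrow> nat) \<Rightarrow> 'v \<Rightarrow> 'v \<Rightarrow> nat \<Rightarrow> bool" where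
  "at_after G arev port b t n \<longleftrightarrow>
     (\<exists>J. n \<le> length (UTH_walk G arev port b J) \<and>
          (b # map (head G) (UTH_walk G arev port b J)) ! n = t)"

definition UTH_finds ::
  "('v, 'e) pre_digraph \<Rightarrow> ('e \<Rightarrow> 'e) \<Rightarrow> ('e \<Rightarrow> nat) \<Rightarrow> 'v \<Rightarrow> 'v \<Rightarrow> bool" where
  "UTH_finds G arev port b t \<longleftrightarrow> (\<exists>n. at_after G arev port b t n)"

definition UTH_time ::
  "('v, 'e) pre_digraph \<Rightarrow> ('e \<Rightarrow> 'e) \<Rightarrow> ('e \<Rightarrow> nat) \<Rightarrow> 'v \<Rightarrow> 'v \<Rightarrow> nat" where
  "UTH_time G arev port b t = (LEAST n. at_after G arev port b t n)"

end

(* Phase j executes, for every pair (x, y) of value j, at most 2 y traversals for each of the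
   sequences of length y with maximum x. For a fixed length y, the sequences executed in phases up to
   J are distinct lists over {1..X}, where X is the largest x with y 2^y x^y <= J; they cost at most
   2 y X^y <= 2 J / 2^y traversals. Summing over y, the first J phases take at most 2 J traversals.
   It remains to see by which phase the treasure is met. A path of type c = (x, y) with x >= 2 is
   executed in phase val c. A path of y ones is a prefix of the sequence 1, ..., 1, 2 of length
   y + 1, executed in phase val (2, y + 1) <= 8 val (2, y). *)
theory Submission
  imports Defs
begin

section \<open>Cost of the first phases\<close>

lemma length_concat_map_sorted_list_of_set:
  fixes A :: "'a::linorder set"
  assumes "finite A"
  shows "length (concat (map f (sorted_list_of_set A))) = (\<Sum>a\<in>A. length (f a))"
  using assms by (simp add: length_concat o_def sum_list_distinct_conv_sum_set)

lemma length_forward_arcs_le: "length (forward_arcs G port v ps) \<le> length ps"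
  by (induction ps arbitrary: v) auto

lemma length_Traverse_le: "length (Traverse G arev port b ps) \<le> 2 * length ps"
  using length_forward_arcs_le[of G port b ps] by (simp add: Traverse_def Let_def)

lemma length_Paths_le:
  assumes "y > 0"
  shows "length (Paths G arev port b (x, y)) \<le> 2 * y * card (port_seqs x y)"
proof -
  have "length (Paths G arev port b (x, y)) =
      (\<Sum>ps\<in>port_seqs x y. length (Traverse G arev port b ps))"
    using assms by (simp add: Paths_def length_concat_map_sorted_list_of_set finite_port_seqs)
  also have "\<dots> \<le> (\<Sum>ps\<in>port_seqs x y. 2 * y)"
    by (rule sum_mono) (use length_Traverse_le in \<open>force simp: port_seqs_def\<close>)
  finally show ?thesis by (simp add: mult.commute)
qed

text \<open>A sequence determines its maximum, so the sets for different \<open>x\<close> are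
  disjoint; all of them lie among the \<open>n ^ y\<close> lists of length \<open>y\<close> over
  \<open>{1..n}\<close>.\<close>

lemma sum_card_port_seqs_le:
  assumes "y > 0" and "X \<subseteq> {1..n}"
  shows "(\<Sum>x\<in>X. card (port_seqs x y)) \<le> n ^ y"
proof -
  have "(\<Sum>x\<in>X. card (port_seqs x y)) = card (\<Union>x\<in>X. port_seqs x y)"
    by (rule card_UN_disjoint[symmetric])
      (use assms finite_subset[OF assms(2)] in
        \<open>simp_all add: finite_port_seqs, auto simp: port_seqs_def\<close>)
  also have "\<dots> \<le> card {ps. set ps \<subseteq> {1..n} \<and> length ps = y}"
  proof (rule card_mono)
    have "p \<le> n" if "p \<in> set ps" "Max (set ps) \<in> X" for p ps
    proof -
      have "p \<le> Max (set ps)" using that(1) by simp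
      also have "\<dots> \<le> n" using that(2) assms(2) by auto
      finally show ?thesis .
    qed
    then show "(\<Union>x\<in>X. port_seqs x y) \<subseteq> {ps. set ps \<subseteq> {1..n} \<and> length ps = y}"
      by (force simp: port_seqs_def)
  qed (simp add: finite_lists_length_eq)
  also have "\<dots> = n ^ y"
    by (simp add: card_lists_length_eq)
  finally show ?thesis .
qed

text \<open>The last summand is the budget still left after \<open>n\<close> terms and makes the
  induction work: the next term and the new budget are each half of the old one, rounded
  down.\<close>

lemma sum_div_power_two_le: "(\<Sum>y=1..n. J div 2 ^ y) + J div 2 ^ n \<le> (J :: nat)"
proof (induction n)
  case (Suc n)
  have "J div 2 ^ Suc n = J div 2 ^ n div 2"
    by (metis div_mult2_eq power_Suc2)
  then have "J div 2 ^ Suc n + J div 2 ^ Suc n \<le> J div 2 ^ n"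
    by linarith
  with Suc show ?case by simp
qed simp

lemma fst_le_val:
  assumes "y > 0"
  shows "x \<le> val (x, y)"
proof -
  have "x \<le> x ^ y" using assms by (cases "x = 0") (simp_all add: self_le_power)
  also have "\<dots> \<le> y * 2 ^ y * x ^ y" using assms by simp
  finally show ?thesis by simp
qed

lemma snd_le_val:
  assumes "x > 0"
  shows "y \<le> val (x, y)"
proof -
  have "y * 1 \<le> y * (2 ^ y * x ^ y)" using assms by (intro mult_le_mono2) simp
  then show ?thesis by (simp add: mult.assoc)
qed

lemma finite_bounded_val: "y > 0 \<Longrightarrow> finite {x. x \<ge> 2 \<and> val (x, y) \<le> J}"
  by (rule finite_subset[of _ "{..J}"]) (auto intro: order_trans[OF fst_le_val] simp del: val.simps)

lemma sum_fixed_length_le: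
  assumes y: "y > 0"
  shows "(\<Sum>x\<in>{x. x \<ge> 2 \<and> val (x, y) \<le> J}. 2 * y * card (port_seqs x y)) \<le> 2 * (J div 2 ^ y)"
\<comment> \<open>The nonempty case uses the maximum \<open>n\<close> of this set;
  \<open>val (n, y) \<le> J\<close> then yields the factor \<open>2 ^ y\<close> to divide
  by.\<close>
proof (cases "{x. x \<ge> 2 \<and> val (x, y) \<le> J} = {}")
  case False
  define X where "X = {x. x \<ge> 2 \<and> val (x, y) \<le> J}"
  have fin: "finite X" using finite_bounded_val[OF y] by (simp add: X_def)
  define n where "n = Max X"
  have "n \<in> X" using Max_in[OF fin] False by (simp add: X_def n_def)
  then have "y * n ^ y * 2 ^ y \<le> J" by (simp add: X_def ac_simps)
  then have n: "y * n ^ y \<le> J div 2 ^ y" by (simp add: less_eq_div_iff_mult_less_eq)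
  have "X \<subseteq> {1..n}" using fin by (auto simp: n_def X_def)
  then have "(\<Sum>x\<in>X. card (port_seqs x y)) \<le> n ^ y" using sum_card_port_seqs_le y by blast
  then have "2 * y * (\<Sum>x\<in>X. card (port_seqs x y)) \<le> 2 * (y * n ^ y)" by simp
  also have "\<dots> \<le> 2 * (J div 2 ^ y)" using n by simp
  finally show ?thesis by (simp add: sum_distrib_left X_def)
next
  case True
  show ?thesis unfolding True by simp
qed

lemma length_UTH_walk_le: "length (UTH_walk G arev port b J) \<le> 2 * J"
proof -
  define P where "P c = length (Paths G arev port b c)" for c
  define X where "X y = {x. x \<ge> 2 \<and> val (x, y) \<le> J}" for y
  have fin: "finite (X y)" if "y > 0" for y
    using finite_bounded_val[OF that] by (simp add: X_def)
  define S where "S = (\<Union>j\<in>{2..<Suc J}. phase_pairs j)"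
  have "length (UTH_walk G arev port b J) = (\<Sum>j\<in>{2..<Suc J}. \<Sum>c\<in>phase_pairs j. P c)"
    by (simp add: UTH_walk_def UTH_phase_def length_concat o_def P_def finite_phase_pairs
        sum_list_distinct_conv_sum_set del: upt_Suc sum.op_ivl_Suc)
  \<comment> \<open>A pair belongs only to the phase numbered by its value, so distinct phases share
    no pair.\<close>
  also have "\<dots> = (\<Sum>c\<in>S. P c)"
    unfolding S_def
    by (rule sum.UNION_disjoint[symmetric])
      (simp_all add: finite_phase_pairs, auto simp: phase_pairs_def)
  \<comment> \<open>Swapping the coordinates puts the length \<open>y\<close> outside, since the
    saving \<open>2 ^ y\<close> appears only after summing over all \<open>x\<close> for fixed
    \<open>y\<close>.\<close>
  also have "\<dots> = (\<Sum>(y, x)\<in>prod.swap ` S. P (x, y))"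
    by (subst sum.reindex) (auto simp: inj_on_def intro!: sum.cong)
  also have "\<dots> \<le> (\<Sum>(y, x)\<in>Sigma {1..J} X. P (x, y))"
  proof (rule sum_mono2)
    show "finite (Sigma {1..J} X)" using fin by auto
    show "prod.swap ` S \<subseteq> Sigma {1..J} X"
    proof
      fix c assume "c \<in> prod.swap ` S"
      then obtain x y where c: "c = (y, x)" and "(x, y) \<in> S" by auto
      then have xy: "x \<ge> 2" "y > 0" "val (x, y) \<le> J"
        by (auto simp: S_def phase_pairs_def)
      then have "y \<le> J" using snd_le_val[of x y] by linarith
      with xy show "c \<in> Sigma {1..J} X" by (simp add: c X_def del: val.simps)
    qed
  qed auto
  also have "\<dots> = (\<Sum>y=1..J. \<Sum>x\<in>X y. P (x, y))"
    by (rule sum.Sigma[symmetric]) (use fin in auto)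
  also have "\<dots> \<le> (\<Sum>y=1..J. \<Sum>x\<in>X y. 2 * y * card (port_seqs x y))"
    by (intro sum_mono) (simp add: P_def length_Paths_le)
  also have "\<dots> \<le> (\<Sum>y=1..J. 2 * (J div 2 ^ y))"
    by (rule sum_mono) (use sum_fixed_length_le in \<open>simp add: X_def\<close>)
  also have "\<dots> \<le> 2 * J"
    using sum_div_power_two_le[of J J] by (simp flip: sum_distrib_left)
  finally show ?thesis .
qed

section \<open>Visited nodes\<close>

lemma forward_arcs_visits:
  assumes "is_path G port u ps v" and "ps \<noteq> []"
  shows "v \<in> head G ` set (forward_arcs G port u (ps @ qs))"
  using assms
proof (induction ps arbitrary: u)
  case (Cons p ps)
  then show ?case by (cases "ps = []") auto
qed simp

lemma UTH_walk_visits: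
  assumes "is_path G port b ps t" and "ps \<noteq> []" and "ps @ qs \<in> port_seqs x y"
    and "x \<ge> 2" and "val (x, y) \<le> J"
  shows "t \<in> head G ` set (UTH_walk G arev port b J)"
proof -
  have y: "y > 0" using assms(2,3) by (auto simp: port_seqs_def)
  define j where "j = val (x, y)"
  \<comment> \<open>With \<open>x \<ge> 2\<close> this gives \<open>j \<ge> 2\<close>, so that
    \<open>j\<close> is indeed the number of a phase.\<close>
  have "x \<le> j" using fst_le_val[OF y] by (simp add: j_def)
  then have "j \<in> set [2..<Suc J]" using assms(4,5) by (simp add: j_def del: val.simps upt_Suc)
  moreover have "(x, y) \<in> phase_pairs j" using y assms(4) by (simp add: phase_pairs_def j_def)
  moreover have "t \<in> head G ` set (Traverse G arev port b (ps @ qs))"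
    using forward_arcs_visits[OF assms(1,2), of qs] by (auto simp: Traverse_def Let_def)
  then have "t \<in> head G ` set (Paths G arev port b (x, y))"
    using assms(3) y by (fastforce simp: Paths_def finite_port_seqs)
  ultimately show ?thesis
    by (fastforce simp: UTH_walk_def UTH_phase_def finite_phase_pairs)
qed

lemma UTH_time_le:
  assumes "t \<in> head G ` set (UTH_walk G arev port b J)"
  shows "UTH_finds G arev port b t \<and> UTH_time G arev port b t \<le> 2 * J"
proof -
  let ?W = "UTH_walk G arev port b J"
  from assms obtain i where i: "i < length ?W" "head G (?W ! i) = t"
    by (auto simp: in_set_conv_nth)
  \<comment> \<open>Arc \<open>i\<close> is traversed as move number \<open>Suc i\<close>; index 0
    of the visited nodes is the base.\<close>
  then have at: "at_after G arev port b t (Suc i)"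
    unfolding at_after_def by (intro exI[of _ J]) simp
  then have "UTH_time G arev port b t \<le> Suc i"
    unfolding UTH_time_def by (rule Least_le)
  with at i(1) length_UTH_walk_le[of G arev port b J] show ?thesis
    unfolding UTH_finds_def by (meson Suc_leI le_trans)
qed

section \<open>Paths and characters\<close>

lemma character_in_path_types:
  assumes "is_path G port u ps v"
  shows "character G port u v \<in> path_types G port u v"
proof -
  have "minval G port u v \<in> val ` path_types G port u v"
    unfolding minval_def by (rule LeastI) (use assms in \<open>auto simp: path_types_def\<close>)
  then obtain c where "c \<in> path_types G port u v \<and> val c = minval G port u v"
    by force
  then have "character G port u v \<in> path_types G port u v \<and>
      val (character G port u v) = minval G port u v"
    unfolding character_def by (rule LeastI)
  then show ?thesis ..
qed

context port_graph
begin

lemma inj_on_port: "v \<in> verts G \<Longrightarrow> inj_on port (out_arcs G v)"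
  using port_finite port_infinite bij_betw_imp_inj_on by blast

text \<open>Ports are injective on the arcs leaving a node, so the definite description in
  \<open>port_arc\<close> has exactly one witness.\<close>

lemma port_arc_port:
  assumes "a \<in> out_arcs G v"
  shows "port_arc G port v (port a) = a"
proof -
  have "v \<in> verts G" using assms by (auto simp: out_arcs_def)
  then show ?thesis
    unfolding port_arc_def using assms inj_on_port[of v] by (auto simp: inj_on_eq_iff)
qed

lemma port_pos:
  assumes "a \<in> out_arcs G v"
  shows "port a > 0"
proof -
  have "v \<in> verts G" using assms by (auto simp: out_arcs_def)
  then have "port ` out_arcs G v \<subseteq> {1..}"
    using port_finite[of v] port_infinite[of v] unfolding bij_betw_def
    by (cases "finite (out_arcs G v)") simp_all
  then show ?thesis using assms by fastforce
qed

lemma is_path_ports_pos: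
  assumes "is_path G port u ps v" and "p \<in> set ps"
  shows "p > 0"
  using assms by (induction ps arbitrary: u) (auto simp: available_def dest: port_pos)

text \<open>The induction extends the walk at its start because \<open>is_path\<close> recurses on
  the first port.\<close>

lemma reachable_imp_is_path:
  assumes "u \<rightarrow>\<^sup>*\<^bsub>G\<^esub> v"
  shows "\<exists>ps. is_path G port u ps v"
  using assms
proof (induction rule: converse_reachable_induct)
  case base
  show ?case by (rule exI[of _ "[]"]) simp
next
  case (step u w)
  from step.hyps(1) obtain a where a: "a \<in> out_arcs G u" "head G a = w"
    by (auto simp: out_arcs_def)
  from step.IH obtain ps where "is_path G port w ps v" by blast
  then have "is_path G port u (port a # ps) v"
    using a by (auto simp: port_arc_port available_def)
  then show ?case by blast
qed

lemma connected_imp_is_path: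
  assumes "connected G" and "u \<in> verts G" and "v \<in> verts G"
  shows "\<exists>ps. is_path G port u ps v"
  \<comment> \<open>Connectedness is strong connectedness of the symmetric closure; arcs of a
    bidirected digraph are already symmetric, so reachability is the same.\<close>
  using assms reachable_mk_symmetric_eq[OF sym_arcs]
  by (intro reachable_imp_is_path) (auto simp: connected_def strongly_connected_def)

lemma UTH_correct:
  assumes "connected G" and "b \<in> verts G" and "t \<in> verts G"
  defines "c \<equiv> character G port b t"
  shows "UTH_finds G arev port b t \<and>
    UTH_time G arev port b t \<le> 16 * (if fst c = 1 then val (2, snd c) else weight G port b t)"
proof (cases "b = t")
  \<comment> \<open>The agent starts at the treasure, so the time is 0 and any bound holds.\<close>
  case True
  then have at: "at_after G arev port b t 0" by (simp add: at_after_def)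
  then have "UTH_time G arev port b t = 0"
    unfolding UTH_time_def by (simp add: Least_eq_0)
  with at show ?thesis unfolding UTH_finds_def by auto
next
  case False
  from connected_imp_is_path[OF assms(1-3)] obtain qs where "is_path G port b qs t" ..
  then have "c \<in> path_types G port b t"
    unfolding c_def by (rule character_in_path_types)
  then obtain ps where ps: "is_path G port b ps t" and c: "c = path_type ps"
    by (auto simp: path_types_def)
  have ne: "ps \<noteq> []" using ps False by auto
  have pos: "\<forall>p\<in>set ps. p > 0" using is_path_ports_pos[OF ps] by blast
  define x y where "x = Max (set ps)" and "y = length ps"
  have cxy: "c = (x, y)" using ne by (simp add: c path_type_def x_def y_def)
  have "x \<in> set ps" using ne by (simp add: x_def)
  then have "x > 0" using pos by blast
  then consider "x \<ge> 2" | "x = 1" by linarith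
  then show ?thesis
  proof cases
    case 1
    have "ps @ [] \<in> port_seqs x y" using pos by (simp add: port_seqs_def x_def y_def)
    note UTH_time_le[OF UTH_walk_visits[OF ps ne this 1 order_refl], of arev]
    moreover have "weight G port b t = val (x, y)"
      using cxy by (simp add: weight_def c_def)
    ultimately show ?thesis using cxy 1 by auto
  next
    case 2
    have ones: "\<forall>p\<in>set ps. p \<le> 1" using 2 by (metis List.finite_set Max_ge x_def)
    \<comment> \<open>The appended 2 raises the maximum to a value that UTH executes. Port 2 need
      not exist at \<open>t\<close>, which has been visited by then.\<close>
    then have "Max (set (ps @ [2])) = 2" by (intro Max_eqI) auto
    then have "ps @ [2] \<in> port_seqs 2 (Suc y)"
      using pos by (simp add: port_seqs_def y_def)
    note UTH_time_le[OF UTH_walk_visits[OF ps ne this order_refl order_refl], of arev]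
    \<comment> \<open>Here \<open>val (2, y)\<close> is \<open>y * 4 ^ y\<close>: passing to
      \<open>Suc y\<close> costs a factor 4 from the power and at most 2 from
      \<open>y + 1 \<le> 2 * y\<close>, as \<open>y \<ge> 1\<close>. Together with the 2 in the walk
      length this is the constant 16.\<close>
    moreover have "2 * val (2, Suc y) \<le> 16 * val (2, y)"
      using ne by (simp add: y_def Suc_le_eq)
    ultimately show ?thesis using cxy 2 by (auto simp del: val.simps)
  qed
qed

end

theorem theorem2p1:
  shows "\<exists>C :: nat. \<forall>(G :: ('v, 'e) pre_digraph) arev port b t.
    port_graph G arev port \<and> connected G \<and> b \<in> verts G \<and> t \<in> verts G \<longrightarrow>
      UTH_finds G arev port b t \<and>
      (fst (character G port b t) \<noteq> 1 \<longrightarrow>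
         UTH_time G arev port b t \<le> C * weight G port b t) \<and>
      (fst (character G port b t) = 1 \<longrightarrow>
         UTH_time G arev port b t \<le> C * val (2, snd (character G port b t)))"
proof (intro exI[of _ 16] allI impI)
  fix G :: "('v, 'e) pre_digraph" and arev port b t
  assume *: "port_graph G arev port \<and> connected G \<and> b \<in> verts G \<and> t \<in> verts G"
  then interpret port_graph G arev port by blast
  show "UTH_finds G arev port b t \<and>
      (fst (character G port b t) \<noteq> 1 \<longrightarrow>
         UTH_time G arev port b t \<le> 16 * weight G port b t) \<and>
      (fst (character G port b t) = 1 \<longrightarrow>
         UTH_time G arev port b t \<le> 16 * val (2, snd (character G port b t)))"
    using UTH_correct[of b t] * by auto
qed

end
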